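(* Let $A\in\mathbb{R}^{n\times n}$ be a (symmetric) negative definite matrix and let $p\le n$. Consider the iteration on $X^{(t)}\in\mathbb{R}^{n\times p}$ with stepsize $\alpha>0$ $$X^{(t+1)}=X^{(t)}-\alpha\left(2AX^{(t)}-AX^{(t)}\,\mathrm{triu}\!\left((X^{(t)})^\top X^{(t)}\right)-X^{(t)}\,\mathrm{triu}\!\left((X^{(t)})^\top AX^{(t)}\right)\right).$$ All fixed points of this iteration are of the form $X=U\,P\,S$ and all stable fixed points are of the form $X=U_p\,D$, where $P\in\mathbb{R}^{n\times p}$ is the first $p$ columns of an arbitrary $n\times n$ permutation matrix, $S\in\mathbb{R}^{p\times p}$ is a diagonal matrix with diagonal entries being $0$ or $\pm1$, and $D\in\mathbb{R}^{p\times p}$ is a diagonal matrix with diagonal entries being $\pm1$.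
   Context: $\mathrm{triu}(M)$ denotes the upper triangular part (including the diagonal) of a square matrix $M$. $\Lambda$ is the diagonal matrix whose diagonal entries are the eigenvalues of $A$ in increasing order, $U$ is an orthogonal matrix satisfying $U^\top AU=\Lambda$, and $U_p$ is the matrix of its first $p$ columns. Write $g_2(X)=2AX-AX\,\mathrm{triu}(X^\top X)-X\,\mathrm{triu}(X^\top AX)$; fixed points are the matrices $X$ with $g_2(X)=0$. Stability of a fixed point $X$ is determined by the spectrum of the Jacobian $\mathrm{D}g_2(X)$, unfolded as an $np\times np$ matrix: $X$ is stable when all eigenvalues of $\mathrm{D}g_2(X)$ are strictly positive, and not stable when $\mathrm{D}g_2(X)$ has a negative eigenvalue.
   Formalization: If A has repeated eigenvalues, the matrix U in X = UPS (and in X = U_pD for fixed points whose Jacobian merely has no negative eigenvalue) may depend on X, as the claim for one fixed U fails (A = -I); for distinct eigenvalues, and for strictly stable points, U is the given one. *)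

theory Defs
  imports "HOL-Analysis.Analysis" "Jordan_Normal_Form.Char_Poly"
begin

definition triu :: "real mat \<Rightarrow> real mat" where
  "triu M = mat (dim_row M) (dim_col M) (\<lambda>(i, j). if i \<le> j then M $$ (i, j) else 0)"

definition negative_definite :: "nat \<Rightarrow> real mat \<Rightarrow> bool" where
  "negative_definite n A \<longleftrightarrow>
     A \<in> carrier_mat n n \<and> transpose_mat A = A \<and>
     (\<forall>v \<in> carrier_vec n. v \<noteq> 0\<^sub>v n \<longrightarrow> v \<bullet> (A *\<^sub>v v) < 0)"

(* The library's orthogonal_mat only asks for pairwise orthogonal nonzero columns, so
   orthonormality is written out.  Since U is orthogonal, the diagonal of L lists exactly the
   eigenvalues of A, with multiplicity. *)
definition ordered_eigendecomposition :: "nat \<Rightarrow> real mat \<Rightarrow> real mat \<Rightarrow> real mat \<Rightarrow> bool" where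
  "ordered_eigendecomposition n A U L \<longleftrightarrow>
     U \<in> carrier_mat n n \<and> transpose_mat U * U = 1\<^sub>m n \<and>
     L \<in> carrier_mat n n \<and> diagonal_mat L \<and> sorted (diag_mat L) \<and>
     transpose_mat U * A * U = L"

definition first_cols :: "nat \<Rightarrow> real mat \<Rightarrow> real mat" where
  "first_cols p M = mat (dim_row M) p (\<lambda>(i, j). M $$ (i, j))"

definition permutation_matrix :: "nat \<Rightarrow> real mat \<Rightarrow> bool" where
  "permutation_matrix n Q \<longleftrightarrow>
     (\<exists>\<pi>. \<pi> permutes {..<n} \<and> Q = mat n n (\<lambda>(i, j). if i = \<pi> j then 1 else 0))"

definition diagonal_with_entries :: "nat \<Rightarrow> real set \<Rightarrow> real mat \<Rightarrow> bool" where
  "diagonal_with_entries p E D \<longleftrightarrow>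
     D \<in> carrier_mat p p \<and> diagonal_mat D \<and> (\<forall>i<p. D $$ (i, i) \<in> E)"

definition g2 :: "real mat \<Rightarrow> real mat \<Rightarrow> real mat" where
  "g2 A X = 2 \<cdot>\<^sub>m (A * X) - A * X * triu (transpose_mat X * X)
              - X * triu (transpose_mat X * A * X)"

definition iteration_step :: "real \<Rightarrow> real mat \<Rightarrow> real mat \<Rightarrow> real mat" where
  "iteration_step \<alpha> A X = X - \<alpha> \<cdot>\<^sub>m g2 A X"

definition fixed_points :: "nat \<Rightarrow> nat \<Rightarrow> real \<Rightarrow> real mat \<Rightarrow> real mat set" where
  "fixed_points n p \<alpha> A = {X \<in> carrier_mat n p. iteration_step \<alpha> A X = X}"

definition elem_mat :: "nat \<Rightarrow> nat \<Rightarrow> nat \<Rightarrow> nat \<Rightarrow> real mat" where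
  "elem_mat n p k l = mat n p (\<lambda>(i, j). if i = k \<and> j = l then 1 else 0)"

(* Matrix of partial derivatives of f : R^(n x p) -> R^(n x p) at X.  Matrices are unfolded
   column by column: entry (i, j) gets the index n * j + i. *)
definition jacobian :: "nat \<Rightarrow> nat \<Rightarrow> (real mat \<Rightarrow> real mat) \<Rightarrow> real mat \<Rightarrow> real mat" where
  "jacobian n p f X = mat (n * p) (n * p) (\<lambda>(r, s).
     deriv (\<lambda>t. f (X + t \<cdot>\<^sub>m elem_mat n p (s mod n) (s div n)) $$ (r mod n, r div n)) 0)"

(* The Jacobian is in general not symmetric, so its eigenvalues are taken over the complex
   numbers. *)
definition stable_point :: "nat \<Rightarrow> nat \<Rightarrow> real mat \<Rightarrow> real mat \<Rightarrow> bool" where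
  "stable_point n p A X \<longleftrightarrow>
     (\<forall>k. eigenvalue (map_mat complex_of_real (jacobian n p (g2 A) X)) k
        \<longrightarrow> k \<in> \<real> \<and> Re k > 0)"

(* Not the negation of stability: a fixed point whose Jacobian has the eigenvalue 0 but no
   negative eigenvalue is neither stable nor unstable. *)
definition unstable_point :: "nat \<Rightarrow> nat \<Rightarrow> real mat \<Rightarrow> real mat \<Rightarrow> bool" where
  "unstable_point n p A X \<longleftrightarrow> (\<exists>k<0. eigenvalue (jacobian n p (g2 A) X) k)"

end

theory Submission
  imports Defs
begin

text \<open>Column \<open>j\<close> of \<open>g2 A X\<close> involves only the columns \<open>x\<^sub>0, \<dots>, x\<^sub>j\<close> of \<open>X\<close>. Hence fixed points are
  analysed column by column: given that the earlier columns are zero or orthonormal eigenvectors,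
  testing the equation for column \<open>j\<close> against them shows that \<open>x\<^sub>j\<close> is orthogonal to them, testing
  it against \<open>x\<^sub>j\<close> shows that \<open>x\<^sub>j\<close> is zero or a unit vector, and what is left is the eigenvector
  equation. For the same reason the Jacobian is block triangular, and an eigenvector of \<open>A\<close> with
  eigenvalue \<open>\<nu>\<close> that is orthogonal to \<open>x\<^sub>0, \<dots>, x\<^sub>j\<close> is an eigenvector of the \<open>j\<close>-th diagonal
  block, with eigenvalue \<open>2 \<nu>\<close> if \<open>x\<^sub>j = 0\<close> and \<open>\<nu> - \<mu>\<close> if \<open>x\<^sub>j\<close> is a unit eigenvector for \<open>\<mu>\<close>. When
  none of these is negative, the columns are nonzero and pick the smallest remaining eigenvalue
  greedily; when all are positive, that eigenvalue is moreover simple on the complement of the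
  columns chosen so far, which determines \<open>x\<^sub>j\<close> up to its sign. Multiple eigenvalues are handled by
  rotating the eigenbasis with reflections until it contains the columns of \<open>X\<close>.\<close>

unbundle no inner_syntax and no vec_syntax

section \<open>Eigenbases of a symmetric matrix\<close>

lemma scalar_prod_self_eq_0_iff:
  fixes v :: "real vec"
  assumes "v \<in> carrier_vec n"
  shows "v \<bullet> v = 0 \<longleftrightarrow> v = 0\<^sub>v n"
proof -
  have "conjugate v = v" by (rule eq_vecI) simp_all
  then show ?thesis using conjugate_square_eq_0_vec[OF assms] by simp
qed

lemma scalar_prod_self_nonneg: "(0 :: real) \<le> v \<bullet> v"
  by (simp add: scalar_prod_def sum_nonneg)

locale symmetric_matrix =
  fixes n :: nat and A :: "real mat"
  assumes A_carrier [simp]: "A \<in> carrier_mat n n"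
    and A_symmetric: "transpose_mat A = A"
begin

lemma A_dim [simp]: "dim_row A = n" "dim_col A = n"
  using carrier_matD[OF A_carrier] .

lemma A_vec_zero [simp]: "A *\<^sub>v 0\<^sub>v n = 0\<^sub>v n"
  by (rule eq_vecI) simp_all

lemma A_vec_carrier [simp]: "v \<in> carrier_vec n \<Longrightarrow> A *\<^sub>v v \<in> carrier_vec n"
  by (rule mult_mat_vec_carrier[OF A_carrier])

lemmas sp_simps = minus_scalar_prod_distrib[of _ n] scalar_prod_minus_distrib[of _ n]
  smult_scalar_prod_distrib[of _ n] scalar_prod_smult_distrib[of _ n]

lemmas A_linear = mult_minus_distrib_mat_vec[OF A_carrier] mult_mat_vec[OF A_carrier]

lemma self_adjoint:
  assumes "v \<in> carrier_vec n" "w \<in> carrier_vec n"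
  shows "v \<bullet> (A *\<^sub>v w) = (A *\<^sub>v v) \<bullet> w"
  using transpose_vec_mult_scalar[OF A_carrier assms(2,1)] A_symmetric by simp

lemma eigenvectors_orthogonal:
  assumes "v \<in> carrier_vec n" "w \<in> carrier_vec n"
    and "A *\<^sub>v v = \<mu> \<cdot>\<^sub>v v" "A *\<^sub>v w = \<nu> \<cdot>\<^sub>v w" "\<mu> \<noteq> \<nu>"
  shows "v \<bullet> w = 0"
  using self_adjoint[OF assms(1,2)] assms by (simp add: sp_simps)

text \<open>The eigenvalues are a separate parameter so that the vectors can be rotated while
  \<open>lam\<close>, and with it the matrix \<open>L\<close>, stays fixed.\<close>

definition eigenbasis :: "(nat \<Rightarrow> real) \<Rightarrow> (nat \<Rightarrow> real vec) \<Rightarrow> bool" where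
  "eigenbasis lam V \<longleftrightarrow>
     (\<forall>i<n. V i \<in> carrier_vec n \<and> A *\<^sub>v V i = lam i \<cdot>\<^sub>v V i) \<and>
     (\<forall>i<n. \<forall>j<n. V i \<bullet> V j = (if i = j then 1 else 0))"

lemma eigenbasis_carrier: "eigenbasis lam V \<Longrightarrow> i < n \<Longrightarrow> V i \<in> carrier_vec n"
  and eigenbasis_eigen: "eigenbasis lam V \<Longrightarrow> i < n \<Longrightarrow> A *\<^sub>v V i = lam i \<cdot>\<^sub>v V i"
  and eigenbasis_orthonormal:
    "eigenbasis lam V \<Longrightarrow> i < n \<Longrightarrow> j < n \<Longrightarrow> V i \<bullet> V j = (if i = j then 1 else 0)"
  by (simp_all add: eigenbasis_def)

text \<open>The n orthonormal vectors are the columns of a square matrix \<open>M\<close>. Its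
  transpose is a left inverse, hence also a right inverse, so \<open>x\<close> is recovered from its
  coordinates, which all vanish.\<close>

lemma eigenbasis_complete:
  assumes V: "eigenbasis lam V" and x: "x \<in> carrier_vec n"
    and orth: "\<And>i. i < n \<Longrightarrow> x \<bullet> V i = 0"
  shows "x = 0\<^sub>v n"
proof -
  define M where "M = mat_of_cols n (map V [0..<n])"
  have M: "M \<in> carrier_mat n n"
    unfolding M_def using mat_of_cols_carrier(1)[of n "map V [0..<n]"] by simp
  have col: "col M i = V i" if "i < n" for i
    unfolding M_def using that eigenbasis_carrier[OF V that] by (subst col_mat_of_cols) auto
  have "transpose_mat M * M = 1\<^sub>m n"
    by (rule eq_matI) (use M in \<open>simp_all add: col eigenbasis_orthonormal[OF V]\<close>)
  then have MM: "M * transpose_mat M = 1\<^sub>m n"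
    using mat_mult_left_right_inverse[of "transpose_mat M" n M] M by simp
  have "transpose_mat M *\<^sub>v x = 0\<^sub>v n"
  proof (rule eq_vecI)
    fix i assume "i < dim_vec (0\<^sub>v n)"
    then have i: "i < n" by simp
    then have "(transpose_mat M *\<^sub>v x) $ i = V i \<bullet> x"
      using M by (simp add: col)
    also have "\<dots> = 0"
      using orth[OF i] comm_scalar_prod[OF eigenbasis_carrier[OF V i] x] by simp
    finally show "(transpose_mat M *\<^sub>v x) $ i = 0\<^sub>v n $ i" using i by simp
  qed (use M in simp)
  then have "M *\<^sub>v (transpose_mat M *\<^sub>v x) = 0\<^sub>v n"
    using M by (intro eq_vecI) simp_all
  moreover have "M *\<^sub>v (transpose_mat M *\<^sub>v x) = x"
    using assoc_mult_mat_vec[of M n n "transpose_mat M" n x] M x MM by simp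
  ultimately show ?thesis by simp
qed

text \<open>A nonzero \<open>x\<close> cannot be orthogonal to the whole basis, and a basis vector
  not orthogonal to it must share its eigenvalue.\<close>

lemma eigenbasis_component:
  assumes V: "eigenbasis lam V" and x: "x \<in> carrier_vec n" "A *\<^sub>v x = \<mu> \<cdot>\<^sub>v x" "x \<noteq> 0\<^sub>v n"
  obtains k where "k < n" "lam k = \<mu>" "x \<bullet> V k \<noteq> 0"
proof -
  obtain k where k: "k < n" "x \<bullet> V k \<noteq> 0"
    using eigenbasis_complete[OF V x(1)] x(3) by blast
  with eigenvectors_orthogonal[OF x(1) eigenbasis_carrier[OF V] x(2) eigenbasis_eigen[OF V]]
  show ?thesis using that by metis
qed

text \<open>The residual of the projection onto \<open>V k\<close> is orthogonal to
  \<open>V k\<close> by construction and to the other basis vectors because their eigenvalues differ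
  from \<open>lam k\<close>. Completeness makes it zero.\<close>

lemma simple_eigenvalue_parallel:
  assumes V: "eigenbasis lam V" and k: "k < n" and inj: "inj_on lam {..<n}"
    and x: "x \<in> carrier_vec n" "A *\<^sub>v x = lam k \<cdot>\<^sub>v x"
  shows "x = (x \<bullet> V k) \<cdot>\<^sub>v V k"
proof -
  let ?y = "x - (x \<bullet> V k) \<cdot>\<^sub>v V k"
  note Vk = eigenbasis_carrier[OF V k]
  have y: "?y \<in> carrier_vec n" using x Vk by simp
  have "?y \<bullet> V i = 0" if i: "i < n" for i
  proof (cases "i = k")
    case True
    then show ?thesis using x Vk eigenbasis_orthonormal[OF V k k] by (simp add: sp_simps)
  next
    case False
    then have "lam k \<noteq> lam i" using inj i k by (auto dest: inj_onD)
    then have "x \<bullet> V i = 0"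
      using eigenvectors_orthogonal[OF x(1) eigenbasis_carrier[OF V i] x(2) eigenbasis_eigen[OF V i]]
      by simp
    then show ?thesis
      using x Vk eigenbasis_carrier[OF V i] eigenbasis_orthonormal[OF V k i] False
      by (simp add: sp_simps)
  qed
  then have "?y = 0\<^sub>v n" using eigenbasis_complete[OF V y] by blast
  then show ?thesis using x Vk by (simp add: vec_eq_iff)
qed

text \<open>The reflection in the hyperplane orthogonal to \<open>V k - x\<close> commutes with \<open>A\<close>, because
  \<open>V k - x\<close> is an eigenvector, swaps \<open>V k\<close> with \<open>x\<close> and fixes what is orthogonal to both.\<close>

lemma eigenbasis_exchange:
  assumes V: "eigenbasis lam V" and k: "k < n"
    and x: "x \<in> carrier_vec n" "A *\<^sub>v x = lam k \<cdot>\<^sub>v x" "x \<bullet> x = 1"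
  obtains V' s where "eigenbasis lam V'" "s \<in> {1, -1}" "x = s \<cdot>\<^sub>v V' k"
    "\<And>i. i < n \<Longrightarrow> i \<noteq> k \<Longrightarrow> x \<bullet> V i = 0 \<Longrightarrow> V' i = V i"
    "x = (x \<bullet> V k) \<cdot>\<^sub>v V k \<Longrightarrow> V' = V"
proof (cases "x = (x \<bullet> V k) \<cdot>\<^sub>v V k")
  \<comment> \<open>Here \<open>x\<close> is \<open>V k\<close> or its negative. Keeping
    \<open>V\<close> and putting the sign into \<open>s\<close> avoids the degenerate reflection
    with \<open>w = 0\<close> and leaves an already adapted basis unaltered.\<close>
  case True
  define c where "c = x \<bullet> V k"
  have xc: "x = c \<cdot>\<^sub>v V k" using True c_def by simp
  have "c * c = 1"
    using x(3) eigenbasis_orthonormal[OF V k k] eigenbasis_carrier[OF V k]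
    unfolding xc by (simp add: sp_simps)
  then have "c \<in> {1, -1}" by (simp add: square_eq_1_iff)
  then show ?thesis using that[of V c] V xc by blast
next
  case False
  note Vk = eigenbasis_carrier[OF V k]
  define w where "w = V k - x"
  have w: "w \<in> carrier_vec n" using Vk x w_def by simp
  have Aw: "A *\<^sub>v w = lam k \<cdot>\<^sub>v w"
    unfolding w_def using Vk x eigenbasis_eigen[OF V k]
    by (auto simp: A_linear vec_eq_iff algebra_simps)
  have Vkk: "V k \<bullet> V k = 1" using eigenbasis_orthonormal[OF V k k] by simp
  have "w \<noteq> 0\<^sub>v n"
  proof
    assume "w = 0\<^sub>v n"
    then have "V k = x" using Vk x by (auto simp: w_def vec_eq_iff)
    with False Vkk show False by simp
  qed
  then have ww0: "w \<bullet> w \<noteq> 0" using scalar_prod_self_eq_0_iff[OF w] by simp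
  \<comment> \<open>Both \<open>V k\<close> and \<open>x\<close> are unit vectors, so both sides are
    2 minus twice their inner product. This makes the coefficient \<open>c k\<close> equal to 1, so
    that \<open>V k\<close> is sent exactly to \<open>x\<close>.\<close>
  have ww: "w \<bullet> w = 2 * (w \<bullet> V k)"
    unfolding w_def using Vk x Vkk comm_scalar_prod[OF Vk x(1)] by (simp add: sp_simps)
  define c where "c i = 2 * (w \<bullet> V i) / (w \<bullet> w)" for i
  define V' where "V' i = V i - c i \<cdot>\<^sub>v w" for i
  have cw: "c i * (w \<bullet> w) = 2 * (w \<bullet> V i)" for i
    using ww0 by (simp add: c_def)
  have "c k = 1" using ww ww0 by (simp add: c_def)
  then have V'k: "V' k = x"
    unfolding V'_def w_def using Vk x by (auto simp: vec_eq_iff)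
  have fix': "V' i = V i" if i: "i < n" "i \<noteq> k" "x \<bullet> V i = 0" for i
  proof -
    note Vi = eigenbasis_carrier[OF V i(1)]
    have "w \<bullet> V i = 0"
      unfolding w_def using i Vi Vk x eigenbasis_orthonormal[OF V k i(1)] by (simp add: sp_simps)
    then show ?thesis unfolding V'_def c_def using Vi w by (auto simp: vec_eq_iff)
  qed
  have "eigenbasis lam V'"
    unfolding eigenbasis_def
  proof (intro conjI allI impI)
    fix i assume i: "i < n"
    note Vi = eigenbasis_carrier[OF V i]
    show "V' i \<in> carrier_vec n" unfolding V'_def using Vi w by simp
    \<comment> \<open>Since \<open>w\<close> lies in the eigenspace of \<open>lam k\<close>, the
      reflection moves only basis vectors with that eigenvalue.\<close>
    have "c i = 0" if "lam i \<noteq> lam k"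
      using eigenvectors_orthogonal[OF w Vi Aw eigenbasis_eigen[OF V i]] that by (simp add: c_def)
    then have "lam k * c i = lam i * c i" by fastforce
    then show "A *\<^sub>v V' i = lam i \<cdot>\<^sub>v V' i"
      unfolding V'_def using Vi w Aw eigenbasis_eigen[OF V i]
      by (auto simp: A_linear vec_eq_iff algebra_simps)
  next
    fix i j assume i: "i < n" and j: "j < n"
    note Vi = eigenbasis_carrier[OF V i] and Vj = eigenbasis_carrier[OF V j]
    have "V' i \<bullet> V' j = V i \<bullet> V j - c j * (w \<bullet> V i) - c i * (w \<bullet> V j) + c j * (c i * (w \<bullet> w))"
      unfolding V'_def using Vi Vj w comm_scalar_prod[OF Vi w] by (simp add: sp_simps algebra_simps)
    also have "c i * (w \<bullet> V j) = c j * (w \<bullet> V i)" by (simp add: c_def)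
    finally show "V' i \<bullet> V' j = (if i = j then 1 else 0)"
      unfolding cw using eigenbasis_orthonormal[OF V i j] by simp
  qed
  moreover have "x = 1 \<cdot>\<^sub>v V' k" by (simp add: V'k)
  ultimately show ?thesis using that[of V' 1] fix' False by blast
qed

section \<open>Columns of a fixed point\<close>

text \<open>The hypothesis says that column \<open>j\<close> of \<open>g2\<close> vanishes, tested against \<open>w\<close>.\<close>

lemma stationary_columns:
  assumes neg: "\<And>v. v \<in> carrier_vec n \<Longrightarrow> v \<noteq> 0\<^sub>v n \<Longrightarrow> v \<bullet> (A *\<^sub>v v) < 0"
    and x: "\<And>j. j < p \<Longrightarrow> x j \<in> carrier_vec n"
    and stationary: "\<And>j w. j < p \<Longrightarrow> w \<in> carrier_vec n \<Longrightarrow>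
      2 * (w \<bullet> (A *\<^sub>v x j)) =
        (\<Sum>c<Suc j. (w \<bullet> (A *\<^sub>v x c)) * (x c \<bullet> x j)) +
        (\<Sum>c<Suc j. (w \<bullet> x c) * (x c \<bullet> (A *\<^sub>v x j)))"
    and "j < p"
  shows "(x j = 0\<^sub>v n \<or> x j \<bullet> x j = 1) \<and> (\<forall>i<j. x i \<bullet> x j = 0) \<and>
    A *\<^sub>v x j = (x j \<bullet> (A *\<^sub>v x j)) \<cdot>\<^sub>v x j"
  using \<open>j < p\<close>
proof (induction j rule: less_induct)
  case (less j)
  note xj = x[OF less.prems]
  define a where "a = x j \<bullet> (A *\<^sub>v x j)"
  have xc: "x c \<in> carrier_vec n" if "c < j" for c
    using x that less.prems by simp
  have orth: "x i \<bullet> x c = 0" if "i < j" "c < j" "i \<noteq> c" for i c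
    using that less.IH[of i] less.IH[of c] less.prems comm_scalar_prod[OF xc xc, of i c]
    by (cases i c rule: linorder_cases) auto
  show ?case
  proof (cases "x j = 0\<^sub>v n")
    case True
    with True show ?thesis using xc by auto
  next
    case False
    have orthj: "x i \<bullet> x j = 0" if i: "i < j" for i
    proof (cases "x i = 0\<^sub>v n")
      case True
      then show ?thesis using xj by simp
    next
      case xi0: False
      define m where "m = x i \<bullet> (A *\<^sub>v x i)"
      have xii: "x i \<bullet> x i = 1" and Axi: "A *\<^sub>v x i = m \<cdot>\<^sub>v x i"
        using less.IH[OF i] i less.prems xi0 by (auto simp: m_def)
      have Axi': "x i \<bullet> (A *\<^sub>v v) = m * (x i \<bullet> v)" if "v \<in> carrier_vec n" for v
        using self_adjoint[OF xc[OF i] that] Axi xc[OF i] that by (simp add: sp_simps)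
      have "m < 0" using neg[OF xc[OF i] xi0] by (simp add: m_def)
      have d: "x i \<bullet> x c = (if c = i then 1 else 0)" if "c < j" for c
        using orth[OF i that] xii by auto
      have "(\<Sum>c<j. (x i \<bullet> (A *\<^sub>v x c)) * (x c \<bullet> x j)) =
          (\<Sum>c<j. if c = i then m * (x i \<bullet> x j) else 0)"
        by (rule sum.cong) (auto simp: Axi' xc d)
      moreover have "(\<Sum>c<j. (x i \<bullet> x c) * (x c \<bullet> (A *\<^sub>v x j))) =
          (\<Sum>c<j. if c = i then m * (x i \<bullet> x j) else 0)"
        by (rule sum.cong) (auto simp: Axi' xj d)
      \<comment> \<open>Testing against \<open>x i\<close> leaves only the terms
        \<open>c = i\<close> and \<open>c = j\<close> of both sums. Negative definiteness makes the
        second factor negative, so the inner product vanishes.\<close>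
      ultimately have "(x i \<bullet> x j) * (m * (x j \<bullet> x j) + a) = 0"
        using stationary[OF less.prems xc[OF i]] i
        by (simp add: Axi' xj sum.delta a_def algebra_simps)
      moreover have "m * (x j \<bullet> x j) \<le> 0"
        using \<open>m < 0\<close> scalar_prod_self_nonneg[of "x j"] by (simp add: mult_nonpos_nonneg)
      moreover have "a < 0" using neg[OF xj False] by (simp add: a_def)
      ultimately show ?thesis by auto
    qed
    \<comment> \<open>With the earlier columns gone, only the term \<open>c = j\<close> survives.
      Below, \<open>w = x j\<close> yields the norm of \<open>x j\<close>, and taking the residual
      \<open>?r\<close> for \<open>w\<close> yields the eigenvector equation.\<close>
    have red: "2 * (w \<bullet> (A *\<^sub>v x j)) = (w \<bullet> (A *\<^sub>v x j)) * (x j \<bullet> x j) + (w \<bullet> x j) * a"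
      if w: "w \<in> carrier_vec n" for w
    proof -
      have "x c \<bullet> (A *\<^sub>v x j) = 0" if c: "c < j" for c
      proof -
        obtain m where "A *\<^sub>v x c = m \<cdot>\<^sub>v x c"
          using less.IH[OF c] c less.prems by auto
        then show ?thesis
          using self_adjoint[OF xc[OF c] xj] orthj[OF c] xc[OF c] xj by (simp add: sp_simps)
      qed
      then have "(\<Sum>c<j. (w \<bullet> x c) * (x c \<bullet> (A *\<^sub>v x j))) = 0"
        by simp
      moreover have "(\<Sum>c<j. (w \<bullet> (A *\<^sub>v x c)) * (x c \<bullet> x j)) = 0"
        using orthj by simp
      ultimately show ?thesis
        using stationary[OF less.prems w] by (simp add: a_def)
    qed
    have "a \<noteq> 0" using neg[OF xj False] by (simp add: a_def)
    then have xjj: "x j \<bullet> x j = 1" using red[OF xj] by (simp add: a_def algebra_simps)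
    let ?r = "A *\<^sub>v x j - a \<cdot>\<^sub>v x j"
    have r: "?r \<in> carrier_vec n" using xj by simp
    have "?r \<bullet> ?r = ?r \<bullet> (A *\<^sub>v x j) - a * (?r \<bullet> x j)"
      using xj by (subst scalar_prod_minus_distrib[of _ n]) (simp_all add: scalar_prod_smult_distrib[of _ n])
    then have "?r \<bullet> ?r = 0" using red[OF r] xjj by (simp add: algebra_simps)
    then have "?r = 0\<^sub>v n" using scalar_prod_self_eq_0_iff[OF r] by simp
    then have "A *\<^sub>v x j = a \<cdot>\<^sub>v x j" using xj by (simp add: vec_eq_iff)
    then show ?thesis using xjj orthj by (auto simp: a_def)
  qed
qed

end

section \<open>Adapting an eigenbasis to the columns of a fixed point\<close>

locale orthonormal_or_zero_eigenvectors = symmetric_matrix +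
  fixes p :: nat and x :: "nat \<Rightarrow> real vec" and \<mu> :: "nat \<Rightarrow> real"
  assumes x_carrier [simp]: "j < p \<Longrightarrow> x j \<in> carrier_vec n"
    and x_eigen: "j < p \<Longrightarrow> A *\<^sub>v x j = \<mu> j \<cdot>\<^sub>v x j"
    and x_unit: "j < p \<Longrightarrow> x j \<noteq> 0\<^sub>v n \<Longrightarrow> x j \<bullet> x j = 1"
    and x_orthogonal: "i < j \<Longrightarrow> j < p \<Longrightarrow> x i \<bullet> x j = 0"
begin

text \<open>Induction on the number of columns treated. A nonzero \<open>x j\<close> meets some
  \<open>V k\<close> with its own eigenvalue, and \<open>k\<close> is new because \<open>x j\<close>
  is orthogonal to the earlier columns; the exchange at \<open>k\<close> leaves the vectors already
  matched in place. Zero columns take no index, so \<open>\<kappa>\<close> is injective only on the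
  nonzero ones. For distinct eigenvalues every exchange is trivial, which keeps
  \<open>V0\<close>.\<close>

lemma eigenbasis_through_columns:
  assumes V0: "eigenbasis lam V0" and "j \<le> p"
  shows "\<exists>V \<kappa>. eigenbasis lam V \<and> (inj_on lam {..<n} \<longrightarrow> V = V0) \<and>
    inj_on \<kappa> {i. i < j \<and> x i \<noteq> 0\<^sub>v n} \<and>
    (\<forall>i<j. x i \<noteq> 0\<^sub>v n \<longrightarrow> \<kappa> i < n \<and> (\<exists>s\<in>{1, -1}. x i = s \<cdot>\<^sub>v V (\<kappa> i)))"
  using \<open>j \<le> p\<close>
proof (induction j)
  case 0
  show ?case using V0 by auto
next
  case (Suc j)
  then have j: "j < p" by simp
  obtain V \<kappa> where V: "eigenbasis lam V" "inj_on lam {..<n} \<longrightarrow> V = V0"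
    and \<kappa>: "inj_on \<kappa> {i. i < j \<and> x i \<noteq> 0\<^sub>v n}"
      "\<And>i. i < j \<Longrightarrow> x i \<noteq> 0\<^sub>v n \<Longrightarrow> \<kappa> i < n"
      "\<And>i. i < j \<Longrightarrow> x i \<noteq> 0\<^sub>v n \<Longrightarrow> \<exists>s\<in>{1, -1}. x i = s \<cdot>\<^sub>v V (\<kappa> i)"
    using Suc by fastforce
  show ?case
  proof (cases "x j = 0\<^sub>v n")
    case True
    then have "{i. i < Suc j \<and> x i \<noteq> 0\<^sub>v n} = {i. i < j \<and> x i \<noteq> 0\<^sub>v n}"
      by (auto simp: less_Suc_eq)
    with True V \<kappa> show ?thesis
      by (intro exI[of _ V] exI[of _ \<kappa>]) (auto simp: less_Suc_eq)
  next
    case False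
    obtain k where k: "k < n" "lam k = \<mu> j" "x j \<bullet> V k \<noteq> 0"
      using eigenbasis_component[OF V(1) x_carrier[OF j] x_eigen[OF j] False] .
    have old: "x j \<bullet> V (\<kappa> i) = 0" "\<kappa> i \<noteq> k" if i: "i < j" "x i \<noteq> 0\<^sub>v n" for i
    proof -
      have xi: "x i \<in> carrier_vec n" using i j by simp
      note Vi = eigenbasis_carrier[OF V(1) \<kappa>(2)[OF i]]
      obtain s where s: "s \<in> {1, -1}" "x i = s \<cdot>\<^sub>v V (\<kappa> i)"
        using \<kappa>(3)[OF i] by blast
      have "x j \<bullet> x i = 0"
        using x_orthogonal[OF i(1) j] comm_scalar_prod[OF xi x_carrier[OF j]] by simp
      then show "x j \<bullet> V (\<kappa> i) = 0"
        using s Vi j by (auto simp: sp_simps)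
      then show "\<kappa> i \<noteq> k" using k by auto
    qed
    obtain V' s where V': "eigenbasis lam V'" "s \<in> {1, -1}" "x j = s \<cdot>\<^sub>v V' k"
      "\<And>i. i < n \<Longrightarrow> i \<noteq> k \<Longrightarrow> x j \<bullet> V i = 0 \<Longrightarrow> V' i = V i"
      "x j = (x j \<bullet> V k) \<cdot>\<^sub>v V k \<Longrightarrow> V' = V"
      using eigenbasis_exchange[OF V(1) k(1) x_carrier[OF j]] x_eigen[OF j] k(2)
        x_unit[OF j False] by metis
    have "V' = V0" if "inj_on lam {..<n}"
    proof -
      have "x j = (x j \<bullet> V k) \<cdot>\<^sub>v V k"
        using simple_eigenvalue_parallel[OF V(1) k(1) that x_carrier[OF j]] x_eigen[OF j] k(2)
        by simp
      then show ?thesis using V'(5) V(2) that by simp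
    qed
    moreover have "inj_on (\<kappa>(j := k)) {i. i < Suc j \<and> x i \<noteq> 0\<^sub>v n}"
      using \<kappa>(1) old(2) by (fastforce simp: inj_on_def less_Suc_eq)
    moreover have "(\<kappa>(j := k)) i < n \<and> (\<exists>s\<in>{1, -1}. x i = s \<cdot>\<^sub>v V' ((\<kappa>(j := k)) i))"
      if i: "i < Suc j" "x i \<noteq> 0\<^sub>v n" for i
    proof (cases "i = j")
      case True
      then show ?thesis using V'(2,3) k by auto
    next
      case ij: False
      then have "i < j" using i by simp
      then show ?thesis using \<kappa>(2,3) V'(4)[OF \<kappa>(2)] old i ij by auto
    qed
    ultimately show ?thesis using V'(1) by blast
  qed
qed

text \<open>The quantity bounded below is an eigenvalue of the Jacobian at the point with columns \<open>x\<close>.\<close>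

lemma eigenbasis_starts_with_columns:
  assumes V0: "eigenbasis lam V0" and "p \<le> n" and "j \<le> p"
    and mono: "\<And>i k. i \<le> k \<Longrightarrow> k < n \<Longrightarrow> lam i \<le> lam k"
    and neg: "\<And>i. i < n \<Longrightarrow> lam i < 0"
    and nonneg: "\<And>j v \<nu>. j < p \<Longrightarrow> v \<in> carrier_vec n \<Longrightarrow> v \<noteq> 0\<^sub>v n \<Longrightarrow>
      A *\<^sub>v v = \<nu> \<cdot>\<^sub>v v \<Longrightarrow> (\<And>c. c \<le> j \<Longrightarrow> x c \<bullet> v = 0) \<Longrightarrow>
      0 \<le> 2 * \<nu> - (x j \<bullet> x j) * \<nu> - x j \<bullet> (A *\<^sub>v x j)"
  shows "\<exists>V. eigenbasis lam V \<and>
    (inj_on lam {..<n} \<or>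
      (\<forall>j v \<nu>. j < p \<longrightarrow> v \<in> carrier_vec n \<longrightarrow> v \<noteq> 0\<^sub>v n \<longrightarrow>
        A *\<^sub>v v = \<nu> \<cdot>\<^sub>v v \<longrightarrow> (\<forall>c\<le>j. x c \<bullet> v = 0) \<longrightarrow>
        0 < 2 * \<nu> - (x j \<bullet> x j) * \<nu> - x j \<bullet> (A *\<^sub>v x j)) \<longrightarrow> V = V0) \<and>
    (\<forall>i<j. \<exists>s\<in>{1, -1}. x i = s \<cdot>\<^sub>v V i)"
    (is "\<exists>V. _ \<and> (_ \<or> ?strict \<longrightarrow> _) \<and> _")
  using \<open>j \<le> p\<close>
proof (induction j)
  case 0
  show ?case using V0 by auto
next
  case (Suc j)
  then have j: "j < p" "j < n" using \<open>p \<le> n\<close> by auto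
  obtain V where V: "eigenbasis lam V" "inj_on lam {..<n} \<or> ?strict \<longrightarrow> V = V0"
      "\<And>i. i < j \<Longrightarrow> \<exists>s\<in>{1, -1}. x i = s \<cdot>\<^sub>v V i"
    using Suc by fastforce
  note Vj = eigenbasis_carrier[OF V(1) j(2)] and Vjj = eigenbasis_orthonormal[OF V(1) j(2) j(2)]
  have Vj0: "V j \<noteq> 0\<^sub>v n" using Vj Vjj by auto
  have earlier: "x i \<bullet> V k = 0" if "i < j" "k < n" "i \<noteq> k" for i k
    using V(3)[OF that(1)] that j eigenbasis_carrier[OF V(1)] eigenbasis_orthonormal[OF V(1), of i k]
    by (auto simp: sp_simps)
  \<comment> \<open>If \<open>x j\<close> were zero, \<open>V j\<close> would be orthogonal to all
    columns up to \<open>j\<close>, and \<open>nonneg\<close> would bound the negative number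
    \<open>2 * lam j\<close> below by 0.\<close>
  have nz: "x j \<noteq> 0\<^sub>v n"
  proof
    assume 0: "x j = 0\<^sub>v n"
    have "x c \<bullet> V j = 0" if "c \<le> j" for c
      using earlier[of c j] that j 0 Vj by (cases "c = j") simp_all
    then have "0 \<le> 2 * lam j"
      using nonneg[OF j(1) Vj Vj0 eigenbasis_eigen[OF V(1) j(2)]] 0 by simp
    with neg[OF j(2)] show False by simp
  qed
  note xj = x_carrier[OF j(1)] and xjj = x_unit[OF j(1) nz]
  have xAx: "x j \<bullet> (A *\<^sub>v x j) = \<mu> j" using x_eigen[OF j(1)] xj xjj by (simp add: sp_simps)
  \<comment> \<open>\<open>x j\<close> has a component along some \<open>V k\<close> with
    \<open>lam k = \<mu> j\<close>, and k is at least j because the earlier basis vectors are taken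
    by the earlier columns; so \<open>lam j\<close> is at most \<open>\<mu> j\<close>. If the two
    differed, \<open>V j\<close> would be orthogonal to all columns up to \<open>j\<close>, and
    \<open>nonneg\<close> would give the reverse inequality.\<close>
  have lamj: "lam j = \<mu> j"
  proof (rule ccontr)
    assume ne: "lam j \<noteq> \<mu> j"
    obtain k where k: "k < n" "lam k = \<mu> j" "x j \<bullet> V k \<noteq> 0"
      using eigenbasis_component[OF V(1) xj x_eigen[OF j(1)] nz] .
    have "j \<le> k"
    proof (rule ccontr)
      assume "\<not> j \<le> k"
      then have kj: "k < j" by simp
      then obtain s where s: "s \<in> {1, -1}" "x k = s \<cdot>\<^sub>v V k" using V(3) by blast
      have "s * (V k \<bullet> x j) = 0"
        using x_orthogonal[OF kj j(1)] s eigenbasis_carrier[OF V(1) k(1)] xj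
        by (simp add: sp_simps)
      then show False
        using k s comm_scalar_prod[OF xj eigenbasis_carrier[OF V(1) k(1)]] by auto
    qed
    have "x j \<bullet> V j = 0"
      using eigenvectors_orthogonal[OF xj Vj x_eigen[OF j(1)] eigenbasis_eigen[OF V(1) j(2)]] ne
      by simp
    then have "x c \<bullet> V j = 0" if "c \<le> j" for c
      using earlier[of c j] that j by (cases "c = j") auto
    then have "\<mu> j \<le> lam j"
      using nonneg[OF j(1) Vj Vj0 eigenbasis_eigen[OF V(1) j(2)]] xjj xAx by simp
    with mono[OF \<open>j \<le> k\<close> k(1)] k(2) ne show False by simp
  qed
  obtain V' s where V': "eigenbasis lam V'" "s \<in> {1, -1}" "x j = s \<cdot>\<^sub>v V' j"
    "\<And>i. i < n \<Longrightarrow> i \<noteq> j \<Longrightarrow> x j \<bullet> V i = 0 \<Longrightarrow> V' i = V i"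
    "x j = (x j \<bullet> V j) \<cdot>\<^sub>v V j \<Longrightarrow> V' = V"
    using eigenbasis_exchange[OF V(1) j(2) xj] x_eigen[OF j(1)] lamj xjj by metis
  have parallel: "x j = (x j \<bullet> V j) \<cdot>\<^sub>v V j" if "inj_on lam {..<n} \<or> ?strict"
    using that
  proof
    assume "inj_on lam {..<n}"
    then show ?thesis
      using simple_eigenvalue_parallel[OF V(1) j(2) _ xj] x_eigen[OF j(1)] lamj by simp
  next
    assume strict: ?strict
    \<comment> \<open>The part of \<open>V j\<close> orthogonal to \<open>x j\<close>, if nonzero,
      is an eigenvector for \<open>\<mu> j\<close> orthogonal to all columns up to \<open>j\<close>.
      The tested quantity is then 0, which strictness forbids. Hence \<open>V j\<close> already
      equals \<open>x j\<close> up to sign and the exchange changes nothing.\<close>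
    define c where "c = x j \<bullet> V j"
    let ?v = "V j - c \<cdot>\<^sub>v x j"
    have v: "?v \<in> carrier_vec n" using Vj xj by simp
    have Av: "A *\<^sub>v ?v = \<mu> j \<cdot>\<^sub>v ?v"
      using Vj xj x_eigen[OF j(1)] eigenbasis_eigen[OF V(1) j(2)] lamj
      by (auto simp: A_linear vec_eq_iff algebra_simps)
    have "x i \<bullet> ?v = 0" if i: "i \<le> j" for i
    proof (cases "i = j")
      case True
      then show ?thesis using Vj xj xjj by (simp add: sp_simps c_def)
    next
      case False
      then show ?thesis
        using i j earlier[of i j] x_orthogonal[of i j] Vj xj by (simp add: sp_simps)
    qed
    moreover have "\<not> 0 < 2 * \<mu> j - (x j \<bullet> x j) * \<mu> j - x j \<bullet> (A *\<^sub>v x j)"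
      using xjj xAx by simp
    ultimately have "?v = 0\<^sub>v n" using strict j(1) v Av by blast
    then have Vc: "V j = c \<cdot>\<^sub>v x j" using Vj xj by (simp add: vec_eq_iff)
    have "c * c = 1"
      using Vjj Vj xj xjj unfolding Vc by (simp add: sp_simps)
    then have "c \<cdot>\<^sub>v V j = x j" unfolding Vc by (simp add: smult_smult_assoc)
    then show ?thesis unfolding c_def by simp
  qed
  have "\<exists>s\<in>{1, -1}. x i = s \<cdot>\<^sub>v V' i" if i: "i < Suc j" for i
  proof (cases "i = j")
    case True
    then show ?thesis using V'(2,3) by auto
  next
    case False
    then have ij: "i < j" "i < n" "i < p" using i j by auto
    then obtain s where s: "s \<in> {1, -1}" "x i = s \<cdot>\<^sub>v V i" using V(3) by blast
    have "s * (V i \<bullet> x j) = 0"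
      using x_orthogonal[OF ij(1) j(1)] s xj eigenbasis_carrier[OF V(1) ij(2)]
      by (simp add: sp_simps)
    then have "x j \<bullet> V i = 0"
      using s comm_scalar_prod[OF xj eigenbasis_carrier[OF V(1) ij(2)]] by auto
    then have "V' i = V i" using V'(4) ij False by simp
    with s show ?thesis by auto
  qed
  moreover have "inj_on lam {..<n} \<or> ?strict \<longrightarrow> V' = V0"
    using parallel V'(5) V(2) by blast
  ultimately show ?case using V'(1) by blast
qed

end

section \<open>Spectrum of the Jacobian\<close>

text \<open>The zero pattern makes \<open>N\<close> block lower triangular with cuts at
  \<open>a\<close> and \<open>a + m\<close>. Applying the block determinant formula at each cut
  exhibits the determinant of the middle block as a factor.\<close>

lemma det_eq_0_if_diagonal_block_singular:
  fixes N :: "'a :: idom mat"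
  assumes N: "N \<in> carrier_mat (a + m + b) (a + m + b)"
    and zero1: "\<And>r s. r < a \<Longrightarrow> a \<le> s \<Longrightarrow> s < a + m + b \<Longrightarrow> N $$ (r, s) = 0"
    and zero2: "\<And>r s. r < a + m \<Longrightarrow> a + m \<le> s \<Longrightarrow> s < a + m + b \<Longrightarrow> N $$ (r, s) = 0"
    and singular: "det (mat m m (\<lambda>(i, k). N $$ (a + i, a + k))) = 0"
  shows "det N = 0"
proof -
  let ?B = "mat m m (\<lambda>(i, k). N $$ (a + i, a + k))"
  let ?C = "four_block_mat ?B (0\<^sub>m m b) (mat b m (\<lambda>(i, k). N $$ (a + m + i, a + k)))
    (mat b b (\<lambda>(i, k). N $$ (a + m + i, a + m + k)))"
  let ?D = "mat a a (\<lambda>(i, k). N $$ (i, k))"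
  have C: "det ?C = 0"
    using singular by (subst det_four_block_mat_upper_right_zero[of _ m _ b]) auto
  have decomp: "N = four_block_mat ?D (0\<^sub>m a (m + b)) (mat (m + b) a (\<lambda>(i, k). N $$ (a + i, k))) ?C"
    by (rule eq_matI) (use N in \<open>auto simp: zero1 zero2\<close>)
  have "det N = det ?D * det ?C"
    unfolding arg_cong[OF decomp, of det]
    by (rule det_four_block_mat_upper_right_zero[of _ a _ "m + b"]) auto
  then show ?thesis unfolding C by simp
qed

text \<open>Subtracting \<open>\<theta>\<close> on the diagonal keeps the triangular shape, so a
  singular block makes the whole matrix singular. Determinants are used because extending an
  eigenvector of the block means solving for its lower components a linear system that may itself be
  singular.\<close>

lemma eigenvalue_of_diagonal_block:
  fixes M :: "'a :: field mat"
  assumes M: "M \<in> carrier_mat (n * p) (n * p)" and j: "j < p"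
    and zero: "\<And>r s. r < n * p \<Longrightarrow> s < n * p \<Longrightarrow> r div n < s div n \<Longrightarrow> M $$ (r, s) = 0"
    and ev: "eigenvalue (mat n n (\<lambda>(i, k). M $$ (n * j + i, n * j + k))) \<theta>"
      (is "eigenvalue ?B _")
  shows "eigenvalue M \<theta>"
proof -
  have n: "n > 0"
  proof (rule ccontr)
    assume "\<not> n > 0"
    then have "v = 0\<^sub>v n" if "v \<in> carrier_vec n" for v :: "'a vec"
      using that by (intro eq_vecI) auto
    with ev show False by (auto simp: eigenvalue_def eigenvector_def)
  qed
  define b where "b = n * (p - Suc j)"
  have dim: "n * p = n * j + n + b"
    using j unfolding b_def by (metis Suc_leI add.commute add_mult_distrib2 le_add_diff_inverse mult_Suc_right)
  let ?N = "char_matrix M \<theta>"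
  have N: "?N \<in> carrier_mat (n * p) (n * p)" using M by (simp add: char_matrix_def)
  have entry: "?N $$ (r, s) = M $$ (r, s) + (if r = s then - \<theta> else 0)"
    if "r < n * p" "s < n * p" for r s
    using M that by (auto simp: char_matrix_def)
  have "char_matrix ?B \<theta> = mat n n (\<lambda>(i, k). ?N $$ (n * j + i, n * j + k))"
    by (rule eq_matI) (auto simp: char_matrix_def[of ?B] entry dim)
  then have singular: "det (mat n n (\<lambda>(i, k). ?N $$ (n * j + i, n * j + k))) = 0"
    using ev eigenvalue_det[of ?B n \<theta>] by simp
  \<comment> \<open>Index \<open>n * q\<close> is the first one of block \<open>q\<close>; the two
    cuts used below are \<open>q = j\<close> and \<open>q = Suc j\<close>.\<close>
  have block_zero: "?N $$ (r, s) = 0"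
    if "r < n * q" "n * q \<le> s" "s < n * p" for q r s
  proof -
    have "r div n < q" "q \<le> s div n"
      using that n by (auto simp: div_less_iff_less_mult less_eq_div_iff_mult_less_eq mult.commute)
    then show ?thesis using that zero[of r s] by (subst entry) auto
  qed
  have "det ?N = 0"
  proof (rule det_eq_0_if_diagonal_block_singular[OF _ _ _ singular])
    show "?N \<in> carrier_mat (n * j + n + b) (n * j + n + b)" using N dim by simp
    show "?N $$ (r, s) = 0" if "r < n * j" "n * j \<le> s" "s < n * j + n + b" for r s
      using block_zero[of r j s] that dim by simp
    show "?N $$ (r, s) = 0" if "r < n * j + n" "n * j + n \<le> s" "s < n * j + n + b" for r s
      using block_zero[of r "Suc j" s] that dim by simp
  qed
  then show ?thesis using eigenvalue_det[OF M] by simp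
qed

section \<open>The map \<open>g2\<close> column by column, and its Jacobian\<close>

context symmetric_matrix
begin

text \<open>In column \<open>j\<close> of a product \<open>Y * triu M\<close>, the coefficients of
  the columns of \<open>Y\<close> beyond \<open>j\<close> are zero. This cut-off at
  \<open>Suc j\<close> is the source of the triangular structure.\<close>

lemma g2_index:
  assumes X: "X \<in> carrier_mat n p" and i: "i < n" and j: "j < p"
  shows "g2 A X $$ (i, j) = 2 * (A *\<^sub>v col X j) $ i
    - (\<Sum>c<Suc j. (A *\<^sub>v col X c) $ i * (col X c \<bullet> col X j))
    - (\<Sum>c<Suc j. col X c $ i * (col X c \<bullet> (A *\<^sub>v col X j)))"
proof -
  have triu_sum: "(Y * triu (transpose_mat X * Z)) $$ (i, j) =
      (\<Sum>c<Suc j. Y $$ (i, c) * (col X c \<bullet> col Z j))"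
    if Y: "Y \<in> carrier_mat n p" and Z: "Z \<in> carrier_mat n p" for Y Z
  proof -
    let ?T = "triu (transpose_mat X * Z)"
    have T: "?T \<in> carrier_mat p p"
      using X Z by (simp add: triu_def)
    have "?T $$ (c, j) = (if c \<le> j then col X c \<bullet> col Z j else 0)" if "c < p" for c
      using X Z that j by (auto simp: triu_def)
    then have "(Y * ?T) $$ (i, j) =
        (\<Sum>c\<in>{0..<p}. Y $$ (i, c) * (if c \<le> j then col X c \<bullet> col Z j else 0))"
      using Y T i j by (simp add: scalar_prod_def)
    also have "\<dots> = (\<Sum>c<Suc j. Y $$ (i, c) * (col X c \<bullet> col Z j))"
      by (rule sum.mono_neutral_cong_right) (use j in auto)
    finally show ?thesis .
  qed
  have AX: "A * X \<in> carrier_mat n p" by (rule mult_carrier_mat[OF A_carrier X])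
  have AX_index: "(A * X) $$ (i, c) = (A *\<^sub>v col X c) $ i" if "c < p" for c
    using X i that by simp
  have assoc: "transpose_mat X * A * X = transpose_mat X * (A * X)"
    using X by (simp add: assoc_mult_mat[of _ p n _ n _ p])
  have dims: "A * X * triu (transpose_mat X * X) \<in> carrier_mat n p"
    "X * triu (transpose_mat X * (A * X)) \<in> carrier_mat n p"
    using X AX by (auto simp: triu_def)
  have "g2 A X $$ (i, j) = 2 * (A * X) $$ (i, j) - (A * X * triu (transpose_mat X * X)) $$ (i, j)
      - (X * triu (transpose_mat X * (A * X))) $$ (i, j)"
    unfolding g2_def assoc using dims AX i j by (simp del: index_mult_mat)
  also have "col (A * X) j = A *\<^sub>v col X j" using X j by (simp add: col_mult2[OF A_carrier X])
  then have "(X * triu (transpose_mat X * (A * X))) $$ (i, j) =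
      (\<Sum>c<Suc j. col X c $ i * (col X c \<bullet> (A *\<^sub>v col X j)))"
    unfolding triu_sum[OF X AX] using X i j by (intro sum.cong) auto
  also have "(A * X * triu (transpose_mat X * X)) $$ (i, j) =
      (\<Sum>c<Suc j. (A *\<^sub>v col X c) $ i * (col X c \<bullet> col X j))"
    unfolding triu_sum[OF AX X] using j by (intro sum.cong) (auto simp: AX_index simp del: index_mult_mat)
  finally show ?thesis using AX_index[OF j] by simp
qed

text \<open>Pairs the vanishing column \<open>j\<close> with \<open>w\<close> and pulls the pairing
  inside the sums, to obtain the hypothesis of \<open>stationary_columns\<close>.\<close>

lemma stationary_if_g2_eq_0:
  assumes X: "X \<in> carrier_mat n p" and g2: "\<And>i. i < n \<Longrightarrow> g2 A X $$ (i, j) = 0"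
    and j: "j < p" and w: "w \<in> carrier_vec n"
  shows "2 * (w \<bullet> (A *\<^sub>v col X j)) =
    (\<Sum>c<Suc j. (w \<bullet> (A *\<^sub>v col X c)) * (col X c \<bullet> col X j)) +
    (\<Sum>c<Suc j. (w \<bullet> col X c) * (col X c \<bullet> (A *\<^sub>v col X j)))"
proof -
  have sp: "w \<bullet> v = (\<Sum>i<n. w $ i * v $ i)" if "v \<in> carrier_vec n" for v
    using that by (simp add: scalar_prod_def lessThan_atLeast0)
  have colX: "col X c \<in> carrier_vec n" for c using X by auto
  have swap: "(\<Sum>c<Suc j. (w \<bullet> f c) * h c) = (\<Sum>i<n. w $ i * (\<Sum>c<Suc j. f c $ i * h c))"
    if "\<And>c. f c \<in> carrier_vec n" for f h
    by (simp only: sp[OF that] sum_distrib_left sum_distrib_right)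
      (subst sum.swap, simp only: mult.assoc)
  have g2': "2 * (A *\<^sub>v col X j) $ i = (\<Sum>c<Suc j. (A *\<^sub>v col X c) $ i * (col X c \<bullet> col X j))
      + (\<Sum>c<Suc j. col X c $ i * (col X c \<bullet> (A *\<^sub>v col X j)))" if "i < n" for i
    using g2[OF that] g2_index[OF X that j] by linarith
  have "2 * (w \<bullet> (A *\<^sub>v col X j)) = (\<Sum>i<n. w $ i * (2 * (A *\<^sub>v col X j) $ i))"
    by (simp only: sp[OF A_vec_carrier[OF colX]] sum_distrib_left) (simp only: mult.left_commute)
  also have "\<dots> = (\<Sum>i<n. w $ i * ((\<Sum>c<Suc j. (A *\<^sub>v col X c) $ i * (col X c \<bullet> col X j))
      + (\<Sum>c<Suc j. col X c $ i * (col X c \<bullet> (A *\<^sub>v col X j)))))"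
    by (intro sum.cong refl) (simp only: lessThan_iff g2')
  finally show ?thesis
    by (simp only: swap[OF A_vec_carrier[OF colX]] swap[OF colX] distrib_left sum.distrib)
qed

lemma col_add_elem_mat:
  assumes "X \<in> carrier_mat n p" "k < n" "c < p"
  shows "col (X + t \<cdot>\<^sub>m elem_mat n p k l) c =
    (if c = l then col X c + t \<cdot>\<^sub>v unit_vec n k else col X c)"
  by (rule eq_vecI) (use assms in \<open>auto simp: elem_mat_def unit_vec_def\<close>)

lemma jacobian_carrier: "jacobian n p f X \<in> carrier_mat (n * p) (n * p)"
  by (simp add: jacobian_def)

text \<open>Column \<open>r div n\<close> of \<open>g2\<close> depends only on the columns up to
  that index, and the perturbed column \<open>s div n\<close> comes later, so the differentiated
  function is constant in \<open>t\<close>.\<close>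

lemma jacobian_g2_above_diagonal:
  assumes X: "X \<in> carrier_mat n p" and r: "r < n * p" and s: "s < n * p"
    and rs: "r div n < s div n"
  shows "jacobian n p (g2 A) X $$ (r, s) = 0"
proof -
  have n: "n > 0" using r by (cases n) auto
  have rn: "r mod n < n" "r div n < p" and sn: "s mod n < n" "s div n < p"
    using n r s by (simp_all add: div_less_iff_less_mult mult.commute)
  let ?Y = "\<lambda>t. X + t \<cdot>\<^sub>m elem_mat n p (s mod n) (s div n)"
  have Y: "?Y t \<in> carrier_mat n p" for t using X by (simp add: elem_mat_def)
  have colY: "col (?Y t) c = col X c" if "c \<le> r div n" for c t
    using that rs rn sn by (subst col_add_elem_mat[OF X]) auto
  have sums: "(\<Sum>c<Suc (r div n). f (col (?Y t) c)) = (\<Sum>c<Suc (r div n). f (col X c))"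
    for f :: "real vec \<Rightarrow> real" and t
    by (intro sum.cong refl) (simp add: colY)
  have "g2 A (?Y t) $$ (r mod n, r div n) = g2 A X $$ (r mod n, r div n)" for t
    unfolding g2_index[OF Y rn] g2_index[OF X rn] colY[OF order_refl]
      sums[where f = "\<lambda>u. (A *\<^sub>v u) $ (r mod n) * (u \<bullet> col X (r div n))"]
      sums[where f = "\<lambda>u. u $ (r mod n) * (u \<bullet> (A *\<^sub>v col X (r div n)))"] ..
  then show ?thesis using r s by (simp add: jacobian_def)
qed

text \<open>Perturbing entry \<open>(k, j)\<close> by \<open>t\<close> makes entry
  \<open>(i, j)\<close> of \<open>g2\<close> a polynomial in \<open>t\<close> of degree at most
  three, whose linear coefficient is the derivative at 0. Self-adjointness of \<open>A\<close>
  merges the two mixed terms of the quadratic form into one with factor 2.\<close>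

lemma jacobian_g2_diagonal_block:
  assumes X: "X \<in> carrier_mat n p" and i: "i < n" and k: "k < n" and j: "j < p"
  shows "jacobian n p (g2 A) X $$ (n * j + i, n * j + k) =
    2 * A $$ (i, k) - (\<Sum>c<j. (A *\<^sub>v col X c) $ i * col X c $ k)
    - (\<Sum>c<j. col X c $ i * (A *\<^sub>v col X c) $ k)
    - (A $$ (i, k) * (col X j \<bullet> col X j) + 2 * (A *\<^sub>v col X j) $ i * col X j $ k)
    - ((if i = k then 1 else 0) * (col X j \<bullet> (A *\<^sub>v col X j)) + 2 * col X j $ i * (A *\<^sub>v col X j) $ k)"
proof -
  have lt: "n * j + m < n * p" if "m < n" for m
  proof -
    have "n * j + m < n * Suc j" using that by simp
    also have "\<dots> \<le> n * p" using j by (intro mult_le_mono2) simp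
    finally show ?thesis .
  qed
  let ?Y = "\<lambda>t. X + t \<cdot>\<^sub>m elem_mat n p k j"
  let ?e = "unit_vec n k :: real vec"
  have Y: "?Y t \<in> carrier_mat n p" for t using X by (simp add: elem_mat_def)
  have colX: "col X c \<in> carrier_vec n" for c using X by auto
  have Ae: "(A *\<^sub>v ?e) $ i = A $$ (i, k)" using i k by simp
  have eAv: "?e \<bullet> (A *\<^sub>v v) = (A *\<^sub>v v) $ k" if "v \<in> carrier_vec n" for v
    using that k by (intro scalar_prod_left_unit[of _ n]) auto
  have vAe: "v \<bullet> (A *\<^sub>v ?e) = (A *\<^sub>v v) $ k" if "v \<in> carrier_vec n" for v
    using self_adjoint[OF that, of ?e] that k by simp
  note lin = scalar_prod_add_distrib[of _ n] add_scalar_prod_distrib[of _ n]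
    mult_add_distrib_mat_vec[OF A_carrier] A_linear sp_simps
  have colj: "col (?Y t) j = col X j + t \<cdot>\<^sub>v ?e" for t
    using col_add_elem_mat[OF X k j] by simp
  have colc: "col (?Y t) c = col X c" if "c < j" for c t
    using col_add_elem_mat[OF X k, of c] j that by simp
  \<comment> \<open>The columns before \<open>j\<close> do not move, so their sums are affine in
    \<open>t\<close>; the last two products are the terms \<open>c = j\<close>.\<close>
  have entry: "g2 A (?Y t) $$ (i, j) =
     2 * ((A *\<^sub>v col X j) $ i + t * A $$ (i, k))
     - ((\<Sum>c<j. (A *\<^sub>v col X c) $ i * (col X c \<bullet> col X j))
       + t * (\<Sum>c<j. (A *\<^sub>v col X c) $ i * col X c $ k))
     - ((\<Sum>c<j. col X c $ i * (col X c \<bullet> (A *\<^sub>v col X j)))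
       + t * (\<Sum>c<j. col X c $ i * (A *\<^sub>v col X c) $ k))
     - ((A *\<^sub>v col X j) $ i + t * A $$ (i, k)) *
         (col X j \<bullet> col X j + 2 * t * col X j $ k + t * t)
     - (col X j $ i + t * (if i = k then 1 else 0)) *
         (col X j \<bullet> (A *\<^sub>v col X j) + 2 * t * (A *\<^sub>v col X j) $ k + t * t * (A *\<^sub>v ?e) $ k)" for t
  proof -
    have s1: "(\<Sum>c<j. (A *\<^sub>v col (?Y t) c) $ i * (col (?Y t) c \<bullet> (col X j + t \<cdot>\<^sub>v ?e))) =
        ((\<Sum>c<j. (A *\<^sub>v col X c) $ i * (col X c \<bullet> col X j))
       + t * (\<Sum>c<j. (A *\<^sub>v col X c) $ i * col X c $ k))"
      unfolding sum_distrib_left sum.distrib[symmetric]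
      using colX k by (intro sum.cong) (simp_all add: algebra_simps colc lin del: index_mult_mat_vec)
    have s2: "(\<Sum>c<j. col (?Y t) c $ i * (col (?Y t) c \<bullet> (A *\<^sub>v (col X j + t \<cdot>\<^sub>v ?e)))) =
        ((\<Sum>c<j. col X c $ i * (col X c \<bullet> (A *\<^sub>v col X j)))
       + t * (\<Sum>c<j. col X c $ i * (A *\<^sub>v col X c) $ k))"
      unfolding sum_distrib_left sum.distrib[symmetric]
      using colX k by (intro sum.cong) (simp_all add: algebra_simps colc lin vAe del: index_mult_mat_vec)
    have a: "(A *\<^sub>v (col X j + t \<cdot>\<^sub>v ?e)) $ i = (A *\<^sub>v col X j) $ i + t * A $$ (i, k)"
      using colX i k by (simp add: lin Ae del: index_mult_mat_vec)
    have b: "(col X j + t \<cdot>\<^sub>v ?e) \<bullet> (col X j + t \<cdot>\<^sub>v ?e) = col X j \<bullet> col X j + 2 * t * col X j $ k + t * t"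
      using colX[of j] k by (simp add: lin algebra_simps)
    have c: "(col X j + t \<cdot>\<^sub>v ?e) $ i = col X j $ i + t * (if i = k then 1 else 0)"
      using colX[of j] i k by auto
    have d: "(col X j + t \<cdot>\<^sub>v ?e) \<bullet> (A *\<^sub>v (col X j + t \<cdot>\<^sub>v ?e)) =
        col X j \<bullet> (A *\<^sub>v col X j) + 2 * t * (A *\<^sub>v col X j) $ k + t * t * (A *\<^sub>v ?e) $ k"
      using colX[of j] k by (simp add: lin eAv vAe algebra_simps del: index_mult_mat_vec)
    show ?thesis
      unfolding g2_index[OF Y i j] sum.lessThan_Suc colj s1 s2 a b c d by (simp add: algebra_simps)
  qed
  have "jacobian n p (g2 A) X $$ (n * j + i, n * j + k) = deriv (\<lambda>t. g2 A (?Y t) $$ (i, j)) 0"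
    using lt[OF i] lt[OF k] i k by (simp add: jacobian_def)
  also have "\<dots> =
    2 * A $$ (i, k) - (\<Sum>c<j. (A *\<^sub>v col X c) $ i * col X c $ k)
    - (\<Sum>c<j. col X c $ i * (A *\<^sub>v col X c) $ k)
    - (A $$ (i, k) * (col X j \<bullet> col X j) + 2 * (A *\<^sub>v col X j) $ i * col X j $ k)
    - ((if i = k then 1 else 0) * (col X j \<bullet> (A *\<^sub>v col X j)) + 2 * col X j $ i * (A *\<^sub>v col X j) $ k)"
    unfolding entry
    by (rule DERIV_imp_deriv) (auto intro!: derivative_eq_intros simp del: index_mult_mat_vec)
  finally show ?thesis .
qed


text \<open>The diagonal block is a combination of \<open>A\<close>, the identity and rank-one
  matrices built from \<open>col X c\<close> and its image under \<open>A\<close>, with c at most j.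
  The rank-one parts annihilate \<open>v\<close>, which is orthogonal to the columns by assumption
  and to their images by self-adjointness. The remainder acts on the eigenvector \<open>v\<close> as
  the stated scalar.\<close>

lemma jacobian_g2_eigenvalue:
  assumes X: "X \<in> carrier_mat n p" and j: "j < p"
    and v: "v \<in> carrier_vec n" "v \<noteq> 0\<^sub>v n" "A *\<^sub>v v = \<nu> \<cdot>\<^sub>v v"
    and orth: "\<And>c. c \<le> j \<Longrightarrow> col X c \<bullet> v = 0"
  shows "eigenvalue (jacobian n p (g2 A) X)
    (2 * \<nu> - (col X j \<bullet> col X j) * \<nu> - col X j \<bullet> (A *\<^sub>v col X j))"
    (is "eigenvalue ?J ?\<theta>")
proof -
  let ?B = "mat n n (\<lambda>(i, k). ?J $$ (n * j + i, n * j + k))"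
  have colX: "col X c \<in> carrier_vec n" for c using X by auto
  have sp: "u \<bullet> v = (\<Sum>k<n. u $ k * v $ k)" for u
    using v(1) by (simp add: scalar_prod_def lessThan_atLeast0)
  have Aorth: "(A *\<^sub>v col X c) \<bullet> v = 0" if "c \<le> j" for c
    using self_adjoint[OF colX v(1), of c] v colX[of c] orth[OF that] by (simp add: sp_simps)
  have "?B *\<^sub>v v = ?\<theta> \<cdot>\<^sub>v v"
  proof (rule eq_vecI)
    fix i assume "i < dim_vec (?\<theta> \<cdot>\<^sub>v v)"
    then have i: "i < n" using v by simp
    have sum1: "(\<Sum>k<n. A $$ (i, k) * v $ k) = \<nu> * v $ i"
    proof -
      have "(\<Sum>k<n. A $$ (i, k) * v $ k) = (A *\<^sub>v v) $ i"
        using i v(1) by (simp add: scalar_prod_def lessThan_atLeast0)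
      also have "\<dots> = \<nu> * v $ i" unfolding v(3) using v(1) i by simp
      finally show ?thesis .
    qed
    have sum2: "(\<Sum>k<n. (\<Sum>c<j. f c * u c $ k) * v $ k) = 0"
      if "\<And>c. c < j \<Longrightarrow> u c \<bullet> v = 0" for f and u :: "nat \<Rightarrow> real vec"
    proof -
      have "(\<Sum>k<n. (\<Sum>c<j. f c * u c $ k) * v $ k) = (\<Sum>c<j. f c * (\<Sum>k<n. u c $ k * v $ k))"
        by (simp only: sum_distrib_left sum_distrib_right) (subst sum.swap, simp only: mult.assoc)
      also have "\<dots> = 0" using that by (simp add: sp)
      finally show ?thesis .
    qed
    have sum3: "(\<Sum>k<n. (if i = k then 1 else 0) * v $ k) = v $ i"
    proof -
      have "(\<Sum>k<n. (if i = k then 1 else 0) * v $ k) = (\<Sum>k<n. if i = k then v $ k else 0)"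
        by (rule sum.cong) auto
      then show ?thesis using i by (simp add: sum.delta)
    qed
    have "(?B *\<^sub>v v) $ i = (\<Sum>k<n. ?J $$ (n * j + i, n * j + k) * v $ k)"
      using i v(1) by (simp add: scalar_prod_def lessThan_atLeast0)
    also have "\<dots> = (\<Sum>k<n. 2 * (A $$ (i, k) * v $ k)
        - (\<Sum>c<j. (A *\<^sub>v col X c) $ i * col X c $ k) * v $ k
        - (\<Sum>c<j. col X c $ i * (A *\<^sub>v col X c) $ k) * v $ k
        - ((col X j \<bullet> col X j) * (A $$ (i, k) * v $ k)
          + 2 * (A *\<^sub>v col X j) $ i * (col X j $ k * v $ k))
        - ((col X j \<bullet> (A *\<^sub>v col X j)) * ((if i = k then 1 else 0) * v $ k)
          + 2 * col X j $ i * ((A *\<^sub>v col X j) $ k * v $ k)))"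
      by (rule sum.cong[OF refl], subst jacobian_g2_diagonal_block[OF X i _ j])
        (simp_all only: lessThan_iff, simp only: algebra_simps)
    also have "\<dots> = 2 * (\<nu> * v $ i) - 0 - 0 - ((col X j \<bullet> col X j) * (\<nu> * v $ i)
          + 2 * (A *\<^sub>v col X j) $ i * (col X j \<bullet> v))
        - ((col X j \<bullet> (A *\<^sub>v col X j)) * v $ i
          + 2 * col X j $ i * ((A *\<^sub>v col X j) \<bullet> v))"
      by (simp only: sum_subtractf sum.distrib sum_distrib_left[symmetric] sum1 sum3
          sum2[OF orth] sum2[OF Aorth] less_imp_le sp[symmetric])
    also have "\<dots> = (?\<theta> \<cdot>\<^sub>v v) $ i"
      using i v(1) orth[OF order_refl] Aorth[OF order_refl]
      by (simp add: algebra_simps del: index_mult_mat_vec)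
    finally show "(?B *\<^sub>v v) $ i = (?\<theta> \<cdot>\<^sub>v v) $ i" .
  qed (use v in simp)
  then have B: "eigenvalue ?B ?\<theta>"
    using v by (auto simp: eigenvalue_def eigenvector_def)
  show ?thesis
    by (rule eigenvalue_of_diagonal_block[OF jacobian_carrier j _ B])
      (rule jacobian_g2_above_diagonal[OF X])
qed

end

section \<open>Matrix factorizations\<close>

lemma mult_diagonal_mat_index:
  fixes D :: "'a :: semiring_0 mat"
  assumes "Y \<in> carrier_mat n p" "D \<in> carrier_mat p p" "diagonal_mat D" "r < n" "i < p"
  shows "(Y * D) $$ (r, i) = Y $$ (r, i) * D $$ (i, i)"
proof -
  have "(Y * D) $$ (r, i) = (\<Sum>c\<in>{0..<p}. Y $$ (r, c) * D $$ (c, i))"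
    using assms by (simp add: scalar_prod_def)
  also have "\<dots> = (\<Sum>c\<in>{0..<p}. if c = i then Y $$ (r, i) * D $$ (i, i) else 0)"
    using assms by (intro sum.cong) (auto simp: diagonal_mat_def)
  finally show ?thesis using assms by simp
qed

lemma col_mult_diagonal_mat:
  fixes D :: "'a :: comm_semiring_0 mat"
  assumes "Y \<in> carrier_mat n p" "D \<in> carrier_mat p p" "diagonal_mat D" "i < p"
  shows "col (Y * D) i = D $$ (i, i) \<cdot>\<^sub>v col Y i"
proof (rule eq_vecI)
  fix r assume "r < dim_vec (D $$ (i, i) \<cdot>\<^sub>v col Y i)"
  then have r: "r < n" using assms(1) by simp
  have "Y * D \<in> carrier_mat n p" using assms(1,2) by (rule mult_carrier_mat)
  then have "col (Y * D) i $ r = (Y * D) $$ (r, i)" using r assms(4) by (metis carrier_matD index_col)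
  also have "\<dots> = Y $$ (r, i) * D $$ (i, i)" by (rule mult_diagonal_mat_index[OF assms(1-3) r assms(4)])
  finally show "col (Y * D) i $ r = (D $$ (i, i) \<cdot>\<^sub>v col Y i) $ r"
    using r assms(1,4) by (simp add: mult.commute)
qed (use assms in simp)

text \<open>Passes from columnwise multiples to a matrix product. The set \<open>E\<close> is left
  open to cover both the factor \<open>S\<close> with entries 0, 1, -1 and the factor
  \<open>D\<close> with entries 1, -1.\<close>

lemma diagonal_factorization:
  assumes X: "X \<in> carrier_mat n p" and Y: "Y \<in> carrier_mat n p"
    and cols: "\<And>i. i < p \<Longrightarrow> \<exists>s\<in>E. col X i = s \<cdot>\<^sub>v col Y i"
  shows "\<exists>D. diagonal_with_entries p E D \<and> X = Y * D"
proof -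
  obtain s where s: "\<And>i. i < p \<Longrightarrow> s i \<in> E" "\<And>i. i < p \<Longrightarrow> col X i = s i \<cdot>\<^sub>v col Y i"
    using cols by metis
  define D where "D = mat p p (\<lambda>(i, j). if i = j then s i else 0)"
  have D: "D \<in> carrier_mat p p" "diagonal_mat D" "\<And>i. i < p \<Longrightarrow> D $$ (i, i) = s i"
    by (auto simp: D_def diagonal_mat_def)
  have "X = Y * D"
  proof (rule mat_col_eqI)
    fix i assume "i < dim_col (Y * D)"
    then have i: "i < p" using D(1) by simp
    show "col X i = col (Y * D) i"
      unfolding col_mult_diagonal_mat[OF Y D(1,2) i] D(3)[OF i] s(2)[OF i] ..
  qed (use X Y D(1) in simp_all)
  then show ?thesis
    using D s(1) by (intro exI[of _ D]) (simp add: diagonal_with_entries_def)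
qed

lemma first_cols_carrier [simp]: "M \<in> carrier_mat n m \<Longrightarrow> first_cols p M \<in> carrier_mat n p"
  by (simp add: first_cols_def)

lemma col_first_cols:
  "M \<in> carrier_mat n m \<Longrightarrow> p \<le> m \<Longrightarrow> i < p \<Longrightarrow> col (first_cols p M) i = col M i"
  by (rule eq_vecI) (auto simp: first_cols_def)

lemma col_mult_permutation_matrix:
  assumes V: "V \<in> carrier_mat n n" and p: "p \<le> n" and i: "i < p" "\<pi> i < n"
  shows "col (V * first_cols p (mat n n (\<lambda>(i, j). if i = \<pi> j then 1 else 0))) i = col V (\<pi> i)"
    (is "col (V * first_cols p ?Q) i = _")
proof -
  have Q: "?Q \<in> carrier_mat n n" by simp
  have "col (V * first_cols p ?Q) i = V *\<^sub>v col ?Q i"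
    using col_mult2[OF V first_cols_carrier[OF Q] i(1)] col_first_cols[OF Q p i(1)] by simp
  also have "col ?Q i = unit_vec n (\<pi> i)"
    by (rule eq_vecI) (use i p in \<open>auto simp: unit_vec_def\<close>)
  also have "V *\<^sub>v unit_vec n (\<pi> i) = col V (\<pi> i)"
    by (rule eq_vecI) (use V i in simp_all)
  finally show ?thesis .
qed

text \<open>The complements of \<open>I\<close> and of its image in the finite set \<open>B\<close>
  have equal size, and any bijection between them completes \<open>\<kappa>\<close>.\<close>

lemma permutation_extending:
  assumes "finite B" "I \<subseteq> B" "inj_on \<kappa> I" "\<kappa> ` I \<subseteq> B"
  obtains \<pi> where "\<pi> permutes B" "\<And>i. i \<in> I \<Longrightarrow> \<pi> i = \<kappa> i"
proof -
  have "card (B - I) = card (B - \<kappa> ` I)"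
    using assms by (simp add: card_Diff_subset finite_subset card_image)
  then obtain h where h: "bij_betw h (B - I) (B - \<kappa> ` I)"
    using assms(1) finite_same_card_bij[of "B - I" "B - \<kappa> ` I"] by auto
  define \<pi> where "\<pi> i = (if i \<in> I then \<kappa> i else if i \<in> B then h i else i)" for i
  have "bij_betw \<pi> I (\<kappa> ` I)"
    using assms(3) by (simp add: bij_betw_def \<pi>_def inj_on_def image_def)
  moreover have "bij_betw \<pi> (B - I) (B - \<kappa> ` I)"
    using h by (rule bij_betw_cong[THEN iffD1, rotated]) (simp add: \<pi>_def)
  ultimately have "bij_betw \<pi> (I \<union> (B - I)) (\<kappa> ` I \<union> (B - \<kappa> ` I))"
    by (rule bij_betw_combine) blast
  moreover have "I \<union> (B - I) = B" "\<kappa> ` I \<union> (B - \<kappa> ` I) = B"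
    using assms by auto
  ultimately have "\<pi> permutes B"
    using assms(2) by (intro bij_imp_permutes) (auto simp: \<pi>_def)
  then show ?thesis using that by (simp add: \<pi>_def)
qed

section \<open>Eigenbases versus ordered eigendecompositions\<close>

context symmetric_matrix
begin

text \<open>The transpose of \<open>U\<close> is also its right inverse, so the diagonalisation
  becomes \<open>A * U = U * L\<close>, whose columns are the eigenvector equations.\<close>

lemma eigenbasis_if_ordered_eigendecomposition:
  assumes "ordered_eigendecomposition n A U L"
  shows "eigenbasis (\<lambda>i. L $$ (i, i)) (col U)"
proof -
  have U: "U \<in> carrier_mat n n" "transpose_mat U * U = 1\<^sub>m n"
    and L: "L \<in> carrier_mat n n" "diagonal_mat L" and UAU: "transpose_mat U * A * U = L"
    using assms by (auto simp: ordered_eigendecomposition_def)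
  have UU: "U * transpose_mat U = 1\<^sub>m n"
    using mat_mult_left_right_inverse[of "transpose_mat U" n U] U by simp
  have AU: "A * U \<in> carrier_mat n n" by (rule mult_carrier_mat[OF A_carrier U(1)])
  have Ut: "transpose_mat U \<in> carrier_mat n n" using U by simp
  have "U * L = U * (transpose_mat U * (A * U))"
    unfolding UAU[symmetric] assoc_mult_mat[OF Ut A_carrier U(1)] ..
  also have "\<dots> = A * U"
    using left_mult_one_mat[OF AU] by (simp only: assoc_mult_mat[OF U(1) Ut AU, symmetric] UU)
  finally have "A *\<^sub>v col U i = L $$ (i, i) \<cdot>\<^sub>v col U i" if "i < n" for i
    using col_mult2[OF A_carrier U(1) that] col_mult_diagonal_mat[OF U(1) L that] by simp
  moreover have "col U i \<bullet> col U j = (if i = j then 1 else 0)" if "i < n" "j < n" for i j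
  proof -
    have "col U i \<bullet> col U j = (transpose_mat U * U) $$ (i, j)" using U(1) that by simp
    then show ?thesis unfolding U(2) using that by simp
  qed
  ultimately show ?thesis using U(1) by (auto simp: eigenbasis_def)
qed

text \<open>Turns a rotated basis back into a matrix. Rotations keep the eigenvalue at each index,
  so the same sorted \<open>L\<close> serves.\<close>

lemma ordered_eigendecomposition_of_eigenbasis:
  assumes L: "L \<in> carrier_mat n n" "diagonal_mat L" "sorted (diag_mat L)"
    and f: "eigenbasis (\<lambda>i. L $$ (i, i)) f"
  shows "\<exists>V. ordered_eigendecomposition n A V L \<and> (\<forall>i<n. col V i = f i)"
proof -
  define V where "V = mat_of_cols n (map f [0..<n])"
  have V: "V \<in> carrier_mat n n"
    unfolding V_def using mat_of_cols_carrier(1)[of n "map f [0..<n]"] by simp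
  have col: "col V i = f i" if "i < n" for i
    unfolding V_def using that eigenbasis_carrier[OF f that] by (subst col_mat_of_cols) auto
  have "transpose_mat V * V = 1\<^sub>m n"
    by (rule eq_matI) (use V in \<open>simp_all add: col eigenbasis_orthonormal[OF f]\<close>)
  moreover have "transpose_mat V * A * V = L"
  proof (rule eq_matI)
    fix i j assume "i < dim_row L" "j < dim_col L"
    then have ij: "i < n" "j < n" using L by auto
    have Vt: "transpose_mat V \<in> carrier_mat n n" using V by simp
    have AV: "A * V \<in> carrier_mat n n" by (rule mult_carrier_mat[OF A_carrier V])
    have "(transpose_mat V * A * V) $$ (i, j) = (transpose_mat V * (A * V)) $$ (i, j)"
      by (simp only: assoc_mult_mat[OF Vt A_carrier V])
    also have "\<dots> = col V i \<bullet> col (A * V) j"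
      using V AV ij by (simp only: index_mult_mat carrier_matD transpose_carrier_mat
          index_transpose_mat row_transpose)
    also have "col (A * V) j = L $$ (j, j) \<cdot>\<^sub>v f j"
      using col_mult2[OF A_carrier V ij(2)] col[OF ij(2)] eigenbasis_eigen[OF f ij(2)] by simp
    also have "col V i \<bullet> \<dots> = L $$ (i, j)"
      using eigenbasis_carrier[OF f] eigenbasis_orthonormal[OF f ij] ij L col
      by (simp add: sp_simps diagonal_mat_def)
    finally show "(transpose_mat V * A * V) $$ (i, j) = L $$ (i, j)" .
  qed (use V L in auto)
  ultimately have "ordered_eigendecomposition n A V L"
    using V L by (simp add: ordered_eigendecomposition_def)
  then show ?thesis using col by blast
qed

lemma g2_carrier: "X \<in> carrier_mat n p \<Longrightarrow> g2 A X \<in> carrier_mat n p"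
  unfolding g2_def by (intro minus_carrier_mat mult_carrier_mat[of _ n p _ p]) (simp_all add: triu_def)

lemma fixed_point_g2:
  assumes "X \<in> fixed_points n p \<alpha> A" "\<alpha> \<noteq> 0" "i < n" "j < p"
  shows "g2 A X $$ (i, j) = 0"
proof -
  have X: "X \<in> carrier_mat n p" "X - \<alpha> \<cdot>\<^sub>m g2 A X = X"
    using assms(1) by (auto simp: fixed_points_def iteration_step_def)
  have "(X - \<alpha> \<cdot>\<^sub>m g2 A X) $$ (i, j) = X $$ (i, j) - \<alpha> * g2 A X $$ (i, j)"
    using g2_carrier[OF X(1)] X(1) assms(3,4) by simp
  with X(2) assms(2) show ?thesis by simp
qed

end

text \<open>With a multiple eigenvalue no single \<open>U\<close> serves all fixed points: for A =
  -I every \<open>X\<close> with orthonormal columns is one. So \<open>V\<close> depends on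
  \<open>X\<close> and is tied to \<open>U\<close> only when the eigenvalues are distinct.
  Stability, however, forces the given \<open>U\<close>; the last claim treats the larger class of
  points without a negative eigenvalue.\<close>

theorem theorem3p2:
  fixes n p :: nat and \<alpha> :: real and A U L :: "real mat"
  assumes "negative_definite n A"
    and "p \<le> n"
    and "\<alpha> > 0"
    and "ordered_eigendecomposition n A U L"
  shows
    "(\<forall>X \<in> fixed_points n p \<alpha> A.
        \<exists>V Q S. ordered_eigendecomposition n A V L \<and> (distinct (diag_mat L) \<longrightarrow> V = U) \<and>
          permutation_matrix n Q \<and> diagonal_with_entries p {0, 1, -1} S \<and>
          X = V * first_cols p Q * S) \<and>
     (\<forall>X \<in> fixed_points n p \<alpha> A. stable_point n p A X \<longrightarrow>
        (\<exists>D. diagonal_with_entries p {1, -1} D \<and> X = first_cols p U * D)) \<and>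
     (\<forall>X \<in> fixed_points n p \<alpha> A. \<not> unstable_point n p A X \<longrightarrow>
        (\<exists>V D. ordered_eigendecomposition n A V L \<and> (distinct (diag_mat L) \<longrightarrow> V = U) \<and>
          diagonal_with_entries p {1, -1} D \<and> X = first_cols p V * D))"
proof -
  have neg: "v \<bullet> (A *\<^sub>v v) < 0" if "v \<in> carrier_vec n" "v \<noteq> 0\<^sub>v n" for v
    using assms(1) that by (simp add: negative_definite_def)
  interpret symmetric_matrix n A
    using assms(1) by unfold_locales (auto simp: negative_definite_def)
  have U: "U \<in> carrier_mat n n" and L: "L \<in> carrier_mat n n" "diagonal_mat L" "sorted (diag_mat L)"
    using assms(4) by (auto simp: ordered_eigendecomposition_def)
  define lam where "lam i = L $$ (i, i)" for i
  have basis: "eigenbasis lam (col U)"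
    using eigenbasis_if_ordered_eigendecomposition[OF assms(4)] unfolding lam_def .
  have diag: "diag_mat L = map lam [0..<n]"
    using L by (simp add: diag_mat_def lam_def)
  have mono: "lam i \<le> lam k" if "i \<le> k" "k < n" for i k
    using sorted_nth_mono[OF L(3), of i k] that by (simp add: diag)
  have distinct: "distinct (diag_mat L) \<longleftrightarrow> inj_on lam {..<n}"
    by (simp add: diag distinct_map lessThan_atLeast0)
  have lam_neg: "lam i < 0" if "i < n" for i
  proof -
    note Ui = eigenbasis_carrier[OF basis that] and Uii = eigenbasis_orthonormal[OF basis that that]
    have "col U i \<noteq> 0\<^sub>v n" using Ui Uii by auto
    from neg[OF Ui this] show ?thesis
      using Ui Uii eigenbasis_eigen[OF basis that] by (simp add: sp_simps)
  qed
  \<comment> \<open>The last conjunct carries an unrotated basis over to the matrix equality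
    \<open>V = U\<close>.\<close>
  have decomposition: "\<exists>V. ordered_eigendecomposition n A V L \<and> (\<forall>i<n. col V i = f i) \<and> (f = col U \<longrightarrow> V = U)"
    if f: "eigenbasis lam f" for f
  proof -
    obtain V where V: "ordered_eigendecomposition n A V L" "\<forall>i<n. col V i = f i"
      using ordered_eigendecomposition_of_eigenbasis[OF L f[unfolded lam_def]] by blast
    have "V = U" if "f = col U"
      by (rule mat_col_eqI)
        (use V U that in \<open>auto simp: ordered_eigendecomposition_def\<close>)
    with V show ?thesis by blast
  qed
  \<comment> \<open>The eigenvalue assigned to a unit column is its Rayleigh quotient; a zero column
    is assigned 0.\<close>
  have columns: "orthonormal_or_zero_eigenvectors n A p (col X) (\<lambda>j. col X j \<bullet> (A *\<^sub>v col X j))"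
    if X: "X \<in> fixed_points n p \<alpha> A" for X
  proof -
    have Xc: "X \<in> carrier_mat n p" using X by (simp add: fixed_points_def)
    have g2: "g2 A X $$ (i, j) = 0" if "i < n" "j < p" for i j
      using fixed_point_g2[OF X _ that] assms(3) by simp
    have c: "col X j \<in> carrier_vec n" for j using Xc by auto
    note stationary = stationary_columns[of p "col X", OF neg c
        stationary_if_g2_eq_0[OF Xc g2]]
    show ?thesis
      by unfold_locales (use c stationary in auto)
  qed
  \<comment> \<open>Serves both stability claims: absence of negative eigenvalues gives the greedy
    choice of basis vectors, and stability adds the strictness that keeps
    \<open>col U\<close>.\<close>
  have start: "\<exists>f. eigenbasis lam f \<and> (distinct (diag_mat L) \<or> stable_point n p A X \<longrightarrow> f = col U) \<and>
      (\<forall>i<p. \<exists>s\<in>{1, -1}. col X i = s \<cdot>\<^sub>v f i)"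
    if X: "X \<in> fixed_points n p \<alpha> A" and not_unstable: "\<not> unstable_point n p A X" for X
  proof -
    interpret orthonormal_or_zero_eigenvectors n A p "col X" "\<lambda>j. col X j \<bullet> (A *\<^sub>v col X j)"
      by (rule columns[OF X])
    have Xc: "X \<in> carrier_mat n p" using X by (simp add: fixed_points_def)
    let ?J = "jacobian n p (g2 A) X"
    let ?th = "\<lambda>j \<nu>. 2 * \<nu> - (col X j \<bullet> col X j) * \<nu> - col X j \<bullet> (A *\<^sub>v col X j)"
    have nonneg: "0 \<le> ?th j \<nu>"
      if "j < p" "v \<in> carrier_vec n" "v \<noteq> 0\<^sub>v n" "A *\<^sub>v v = \<nu> \<cdot>\<^sub>v v"
        "\<And>c. c \<le> j \<Longrightarrow> col X c \<bullet> v = 0" for j v \<nu>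
      using jacobian_g2_eigenvalue[OF Xc that] not_unstable
      by (auto simp: unstable_point_def not_less[symmetric])
    let ?strict = "\<forall>j v \<nu>. j < p \<longrightarrow> v \<in> carrier_vec n \<longrightarrow> v \<noteq> 0\<^sub>v n \<longrightarrow>
        A *\<^sub>v v = \<nu> \<cdot>\<^sub>v v \<longrightarrow> (\<forall>c\<le>j. col X c \<bullet> v = 0) \<longrightarrow> 0 < ?th j \<nu>"
    have strict: ?strict
      if stable: "stable_point n p A X"
    proof (intro allI impI)
      fix j v \<nu>
      assume "j < p" "v \<in> carrier_vec n" "v \<noteq> 0\<^sub>v n" "A *\<^sub>v v = \<nu> \<cdot>\<^sub>v v" "\<forall>c\<le>j. col X c \<bullet> v = 0"
      then have "eigenvalue ?J (?th j \<nu>)"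
        by (intro jacobian_g2_eigenvalue[OF Xc]) auto
      \<comment> \<open>Stability is stated over the complex numbers, so the real eigenvalue is
        carried along the embedding of the reals.\<close>
      then have "eigenvalue (map_mat complex_of_real ?J) (complex_of_real (?th j \<nu>))"
        by (rule of_real_hom.eigenvalue_hom[OF jacobian_carrier])
      then have "Re (complex_of_real (?th j \<nu>)) > 0"
        using stable unfolding stable_point_def by blast
      then show "0 < ?th j \<nu>" by (simp only: Re_complex_of_real)
    qed
    have "\<exists>f. eigenbasis lam f \<and> (inj_on lam {..<n} \<or> ?strict \<longrightarrow> f = col U) \<and>
        (\<forall>i<p. \<exists>s\<in>{1, -1}. col X i = s \<cdot>\<^sub>v f i)"
      by (rule eigenbasis_starts_with_columns[OF basis assms(2) order_refl mono lam_neg nonneg])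
    then obtain f where f: "eigenbasis lam f" "inj_on lam {..<n} \<or> ?strict \<longrightarrow> f = col U"
      "\<forall>i<p. \<exists>s\<in>{1, -1}. col X i = s \<cdot>\<^sub>v f i"
      by (elim exE conjE)
    have "distinct (diag_mat L) \<or> stable_point n p A X \<longrightarrow> f = col U"
      unfolding distinct by (intro impI f(2)[THEN mp]) (erule disj_forward[OF _ _ strict]; assumption)
    with f(1,3) show ?thesis by (intro exI[of _ f] conjI)
  qed
  have stable_not_unstable: "\<not> unstable_point n p A X" if "stable_point n p A X" for X
  proof
    assume "unstable_point n p A X"
    then obtain k where k: "k < 0" "eigenvalue (jacobian n p (g2 A) X) k"
      by (auto simp: unstable_point_def)
    from of_real_hom.eigenvalue_hom[OF jacobian_carrier k(2)] that
    have "Re (complex_of_real k) > 0" unfolding stable_point_def by blast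
    with k(1) show False by simp
  qed
  show ?thesis
  proof (intro conjI ballI impI)
    fix X assume X: "X \<in> fixed_points n p \<alpha> A"
    interpret orthonormal_or_zero_eigenvectors n A p "col X" "\<lambda>j. col X j \<bullet> (A *\<^sub>v col X j)"
      by (rule columns[OF X])
    have Xc: "X \<in> carrier_mat n p" using X by (simp add: fixed_points_def)
    let ?I = "{i. i < p \<and> col X i \<noteq> 0\<^sub>v n}"
    obtain f \<kappa> where f: "eigenbasis lam f" "inj_on lam {..<n} \<longrightarrow> f = col U"
      and \<kappa>: "inj_on \<kappa> ?I"
        "\<forall>i<p. col X i \<noteq> 0\<^sub>v n \<longrightarrow> \<kappa> i < n \<and> (\<exists>s\<in>{1, -1}. col X i = s \<cdot>\<^sub>v f (\<kappa> i))"
      using eigenbasis_through_columns[OF basis order_refl] by blast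
    obtain V where V: "ordered_eigendecomposition n A V L" "\<And>i. i < n \<Longrightarrow> col V i = f i"
      "f = col U \<Longrightarrow> V = U"
      using decomposition[OF f(1)] by blast
    have Vc: "V \<in> carrier_mat n n" using V(1) by (simp add: ordered_eigendecomposition_def)
    \<comment> \<open>Nonzero columns dictate \<open>\<pi>\<close> through \<open>\<kappa>\<close>;
      each zero column gets one of the remaining indices, with entry 0 in \<open>S\<close>.\<close>
    obtain \<pi> where \<pi>: "\<pi> permutes {..<n}" "\<And>i. i \<in> ?I \<Longrightarrow> \<pi> i = \<kappa> i"
      by (rule permutation_extending[of "{..<n}" ?I \<kappa>]) (use \<kappa> assms(2) in auto)
    let ?Q = "mat n n (\<lambda>(i, j). if i = \<pi> j then 1 else 0) :: real mat"
    have Q: "permutation_matrix n ?Q" using \<pi>(1) unfolding permutation_matrix_def by blast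
    have Y: "V * first_cols p ?Q \<in> carrier_mat n p"
      using Vc by (intro mult_carrier_mat first_cols_carrier) auto
    have "\<exists>s\<in>{0, 1, -1}. col X i = s \<cdot>\<^sub>v col (V * first_cols p ?Q) i" if i: "i < p" for i
    proof -
      have \<pi>i: "\<pi> i < n" using permutes_in_image[OF \<pi>(1), of i] i assms(2) by simp
      have col: "col (V * first_cols p ?Q) i = f (\<pi> i)"
        using col_mult_permutation_matrix[where \<pi> = \<pi>, OF Vc assms(2) i \<pi>i] V(2)[OF \<pi>i] by simp
      show ?thesis
      proof (cases "col X i = 0\<^sub>v n")
        case True
        have "f (\<pi> i) \<in> carrier_vec n" using eigenbasis_carrier[OF f(1) \<pi>i] .
        then have "0\<^sub>v n = 0 \<cdot>\<^sub>v f (\<pi> i)" by (intro eq_vecI) auto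
        then show ?thesis unfolding True col by blast
      next
        case False
        then show ?thesis unfolding col using \<kappa>(2) \<pi>(2)[of i] i by auto
      qed
    qed
    from diagonal_factorization[OF Xc Y this] Q V f(2)
    show "\<exists>V Q S. ordered_eigendecomposition n A V L \<and> (distinct (diag_mat L) \<longrightarrow> V = U) \<and>
          permutation_matrix n Q \<and> diagonal_with_entries p {0, 1, -1} S \<and>
          X = V * first_cols p Q * S"
      unfolding distinct by blast
  next
    fix X assume X: "X \<in> fixed_points n p \<alpha> A" and stable: "stable_point n p A X"
    then have "\<forall>i<p. \<exists>s\<in>{1, -1}. col X i = s \<cdot>\<^sub>v col U i"
      using start[OF X stable_not_unstable[OF stable]] by blast
    then show "\<exists>D. diagonal_with_entries p {1, -1} D \<and> X = first_cols p U * D"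
      using X U assms(2)
      by (intro diagonal_factorization[of _ n]) (auto simp: fixed_points_def col_first_cols[OF U])
  next
    fix X assume X: "X \<in> fixed_points n p \<alpha> A" and not_unstable: "\<not> unstable_point n p A X"
    obtain f where f: "eigenbasis lam f" "distinct (diag_mat L) \<longrightarrow> f = col U"
      "\<forall>i<p. \<exists>s\<in>{1, -1}. col X i = s \<cdot>\<^sub>v f i"
      using start[OF X not_unstable] by blast
    obtain V where V: "ordered_eigendecomposition n A V L" "\<And>i. i < n \<Longrightarrow> col V i = f i"
      "f = col U \<Longrightarrow> V = U"
      using decomposition[OF f(1)] by blast
    have Vc: "V \<in> carrier_mat n n" using V(1) by (simp add: ordered_eigendecomposition_def)
    have "\<exists>D. diagonal_with_entries p {1, -1} D \<and> X = first_cols p V * D"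
      using X Vc assms(2) f(3) V(2)
      by (intro diagonal_factorization[of _ n]) (auto simp: fixed_points_def col_first_cols[OF Vc])
    with V f(2) show "\<exists>V D. ordered_eigendecomposition n A V L \<and> (distinct (diag_mat L) \<longrightarrow> V = U) \<and>
          diagonal_with_entries p {1, -1} D \<and> X = first_cols p V * D"
      by blast
  qed
qed

end
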